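(* Let $(\Sigma,\mathcal T,\eta)$ be a weighted triangulated surface with boundary carrying a mixed discrete conformal structure III on $\Omega(\eta)$. Suppose one of the following holds: (1) all right-angled hyperbolic hexagons are Type-III, and for each of them (with distinguished component $i$) $\eta$ satisfies one of the conditions (i)–(iv) below; (2) not all hexagons are Type-III; for each Type-III hexagon $\eta$ satisfies one of the conditions (i)–(iv) below, and for each hexagon all of whose edges are of kind (A3), $\eta>0$ on its edges. Conditions on a Type-III hexagon $\{ijk\}$ with distinguished component $i$: (i) $\eta_{jk}>0$, $\eta_{ij}>0$, $\eta_{ik}>0$; (ii) $\eta_{jk}>0$, $\eta_{ij}>0$, $\eta_{ik}\le0$, $\eta_{jk}+\eta_{ik}\le0$; (iii) $\eta_{jk}>0$, $\eta_{ij}\le0$, $\eta_{ik}>0$, $\eta_{jk}+\eta_{ij}\le0$; (iv) $\eta_{jk}>0$, $\eta_{ij}\le0$, $\eta_{ik}\le0$, $\eta_{jk}+\eta_{ij}\le0$, $\eta_{jk}+\eta_{ik}\le0$. Then the discrete conformal factor $f\in\Omega(\eta)$ is uniquely determined by its generalized combinatorial curvature $K\in\mathbb R^N_{>0}$ (the map $f\mapsto K$ is injective on $\Omega(\eta)$).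
   Context: $\Sigma$ is a compact surface with boundary components indexed by $B=\{1,\dots,N\}$, obtained from a triangulated closed surface with $N$ vertices by removing small disjoint open disk neighbourhoods of the vertices; $\mathcal T$ is the induced ideal triangulation with ideal edges $\{ij\}\in E$, oriented edges $E_+$, and hexagonal ideal faces $\{ijk\}\in F$. Given $l\in\mathbb R^E_{>0}$, the face $\{ijk\}$ is the right-angled hyperbolic hexagon with three pairwise non-adjacent sides $l_{ij},l_{jk},l_{ki}$, and $\theta_i^{jk}>0$ is the length of its side at $i$: $\cosh\theta_i^{jk}=\frac{\cosh l_{jk}+\cosh l_{ij}\cosh l_{ik}}{\sinh l_{ij}\sinh l_{ik}}$. $K_i=\sum_{\{ijk\}\in F}\theta_i^{jk}$. A discrete conformal structure is a smooth map $f\mapsto d(f)\in\mathbb R^{E_+}$ on the admissible space $\Omega(\eta)\subseteq\mathbb R^N$ with $l_{ij}=d_{ij}+d_{ji}>0$, $\sinh d_{ij}\sinh d_{jk}\sinh d_{ki}=\sinh d_{ji}\sinh d_{kj}\sinh d_{ik}$ on each face, $\partial l_{ij}/\partial f_i=\coth d_{ij}$, and $\partial d_{ij}/\partial f_k=0$ for $k\ne i,j$. Mixed III (with $C\equiv0$): each edge is of kind (A3): $\frac{\sinh d_{ij}}{\sinh d_{ji}}=e^{f_i-f_j}$, $\cosh l_{ij}=-\cosh(f_j-f_i)+\eta_{ij}e^{f_i+f_j}$; or (B3): $\frac{\sinh d_{ij}}{\sinh d_{ji}}=-e^{f_i-f_j}$, $\cosh l_{ij}=\cosh(f_j-f_i)+\eta_{ij}e^{f_i+f_j}$;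 at least one edge is of kind (B3); and every face either has all edges of kind (A3) or is Type-III: it has a distinguished component $i$ with $d_{ij},d_{ik}<0$, $d_{ji},d_{ki},d_{jk},d_{kj}>0$, edges $\{ij\},\{ik\}$ of kind (B3) and $\{jk\}$ of kind (A3). $\Omega(\eta)$ is the set of $f\in\mathbb R^N$ such that the right-hand side of the formula for $\cosh l_{ij}$ is $>1$ for every edge. *)

theory Defs
  imports "HOL-Analysis.Analysis"
begin

section \<open>Triangulated closed surfaces\<close>

text \<open>
  A triangulated closed surface is given combinatorially, by the set \<open>F\<close> of its faces: every
  face is a set of three vertices, every edge lies in exactly two faces, and the faces around a
  vertex form a single cycle (the link of the vertex is 2-regular by the condition on the edges, and
  it is required to be connected). The vertex set is a whole finite type \<open>'n\<close>. Removing a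
  small open disk around each vertex turns the vertices into the boundary components, the edges
  into the ideal edges and the faces into the hexagonal ideal faces of the surface with boundary,
  so that \<open>N\<close> is \<open>CARD('n)\<close> and functions on the set of boundary components
  are vectors in \<open>real ^ 'n\<close>. Connectedness and orientability are not required.
\<close>

definition edges :: "'n set set \<Rightarrow> 'n set set" where
  "edges F = {e. card e = 2 \<and> (\<exists>t\<in>F. e \<subseteq> t)}"

definition link_rel :: "'n set set \<Rightarrow> 'n \<Rightarrow> ('n \<times> 'n) set" where
  "link_rel F v = {(a, b). {v, a, b} \<in> F}"

definition triangulated_closed_surface :: "'n::finite set set \<Rightarrow> bool" where
  "triangulated_closed_surface F \<longleftrightarrow>
     (\<forall>t\<in>F. card t = 3) \<and>
     \<Union>F = UNIV \<and>
     (\<forall>e\<in>edges F. card {t\<in>F. e \<subseteq> t} = 2) \<and>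
     (\<forall>v a b. {v, a} \<in> edges F \<and> {v, b} \<in> edges F \<longrightarrow> (a, b) \<in> (link_rel F v)\<^sup>*)"

section \<open>Smooth functions and partial derivatives\<close>

text \<open>Intended for open sets \<open>S\<close>.\<close>

fun Ck_on :: "nat \<Rightarrow> 'a::real_normed_vector set \<Rightarrow> ('a \<Rightarrow> real) \<Rightarrow> bool" where
  "Ck_on 0 S g \<longleftrightarrow> continuous_on S g"
| "Ck_on (Suc k) S g \<longleftrightarrow>
     (\<forall>x\<in>S. g differentiable (at x)) \<and>
     (\<forall>v. Ck_on k S (\<lambda>x. frechet_derivative g (at x) v))"

definition smooth_on :: "'a::real_normed_vector set \<Rightarrow> ('a \<Rightarrow> real) \<Rightarrow> bool" where
  "smooth_on S g \<longleftrightarrow> (\<forall>k. Ck_on k S g)"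

definition has_partial_derivative ::
    "(real ^ 'n::finite \<Rightarrow> real) \<Rightarrow> 'n \<Rightarrow> real \<Rightarrow> real ^ 'n \<Rightarrow> bool" where
  "has_partial_derivative g i D f \<longleftrightarrow>
     ((\<lambda>t. g (f + t *\<^sub>R axis i 1)) has_real_derivative D) (at 0)"

section \<open>Discrete conformal structures\<close>

text \<open>
  The value \<open>d f i j\<close> is the number $d_{ij}(f)$ of the oriented edge from \<open>i\<close> to
  \<open>j\<close>; values of \<open>d\<close> off the oriented edges are irrelevant.
\<close>

type_synonym 'n edge_map = "real ^ 'n \<Rightarrow> 'n \<Rightarrow> 'n \<Rightarrow> real"

definition len :: "'n::finite edge_map \<Rightarrow> real ^ 'n \<Rightarrow> 'n \<Rightarrow> 'n \<Rightarrow> real" where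
  "len d f i j = d f i j + d f j i"

definition coth :: "real \<Rightarrow> real" where
  "coth x = cosh x / sinh x"

definition discrete_conformal_structure ::
    "'n::finite set set \<Rightarrow> (real ^ 'n) set \<Rightarrow> 'n edge_map \<Rightarrow> bool" where
  "discrete_conformal_structure F \<Omega> d \<longleftrightarrow>
     (\<forall>i j. {i, j} \<in> edges F \<longrightarrow>
        smooth_on \<Omega> (\<lambda>f. d f i j) \<and>
        (\<forall>f\<in>\<Omega>.
           len d f i j > 0 \<and>
           d f i j \<noteq> 0 \<and>
           has_partial_derivative (\<lambda>g. len d g i j) i (coth (d f i j)) f \<and>
           (\<forall>k. k \<noteq> i \<and> k \<noteq> j \<longrightarrow> has_partial_derivative (\<lambda>g. d g i j) k 0 f))) \<and>
     (\<forall>i j k. {i, j, k} \<in> F \<longrightarrow>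
        (\<forall>f\<in>\<Omega>. sinh (d f i j) * sinh (d f j k) * sinh (d f k i) =
              sinh (d f j i) * sinh (d f k j) * sinh (d f i k)))"

section \<open>Mixed discrete conformal structures III\<close>

text \<open>
  The weight \<open>\<eta>\<close> is a function on unoriented edges, and \<open>B\<close> is the set of the
  edges of kind (B3); the remaining edges are of kind (A3). Both are independent of \<open>f\<close>.
\<close>

definition cosh_len_rhs ::
    "'n::finite set set \<Rightarrow> ('n set \<Rightarrow> real) \<Rightarrow> real ^ 'n \<Rightarrow> 'n \<Rightarrow> 'n \<Rightarrow> real" where
  "cosh_len_rhs B \<eta> f i j =
     (if {i, j} \<in> B
      then cosh (f $ j - f $ i) + \<eta> {i, j} * exp (f $ i + f $ j)
      else - cosh (f $ j - f $ i) + \<eta> {i, j} * exp (f $ i + f $ j))"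

definition admissible_space ::
    "'n::finite set set \<Rightarrow> 'n set set \<Rightarrow> ('n set \<Rightarrow> real) \<Rightarrow> (real ^ 'n) set" where
  "admissible_space F B \<eta> =
     {f. \<forall>i j. {i, j} \<in> edges F \<longrightarrow> cosh_len_rhs B \<eta> f i j > 1}"

definition all_A3 :: "'n set set \<Rightarrow> 'n set \<Rightarrow> bool" where
  "all_A3 B t \<longleftrightarrow> (\<forall>e. e \<subseteq> t \<and> card e = 2 \<longrightarrow> e \<notin> B)"

text \<open>The face \<open>{i, j, k}\<close> is Type-III with distinguished component \<open>i\<close>.\<close>

definition type_III ::
    "'n::finite set set \<Rightarrow> 'n set set \<Rightarrow> ('n set \<Rightarrow> real) \<Rightarrow> 'n edge_map \<Rightarrow>
      'n \<Rightarrow> 'n \<Rightarrow> 'n \<Rightarrow> bool" where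
  "type_III F B \<eta> d i j k \<longleftrightarrow>
     {i, j, k} \<in> F \<and> {i, j} \<in> B \<and> {i, k} \<in> B \<and> {j, k} \<notin> B \<and>
     (\<forall>f\<in>admissible_space F B \<eta>.
        d f i j < 0 \<and> d f i k < 0 \<and>
        d f j i > 0 \<and> d f k i > 0 \<and> d f j k > 0 \<and> d f k j > 0)"

definition type_III_face ::
    "'n::finite set set \<Rightarrow> 'n set set \<Rightarrow> ('n set \<Rightarrow> real) \<Rightarrow> 'n edge_map \<Rightarrow>
      'n set \<Rightarrow> bool" where
  "type_III_face F B \<eta> d t \<longleftrightarrow> (\<exists>i j k. t = {i, j, k} \<and> type_III F B \<eta> d i j k)"

definition mixed_structure_III ::
    "'n::finite set set \<Rightarrow> 'n set set \<Rightarrow> ('n set \<Rightarrow> real) \<Rightarrow> 'n edge_map \<Rightarrow> bool" where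
  "mixed_structure_III F B \<eta> d \<longleftrightarrow>
     B \<subseteq> edges F \<and> B \<noteq> {} \<and>
     discrete_conformal_structure F (admissible_space F B \<eta>) d \<and>
     (\<forall>f\<in>admissible_space F B \<eta>. \<forall>i j. {i, j} \<in> edges F \<longrightarrow>
        sinh (d f i j) / sinh (d f j i) =
          (if {i, j} \<in> B then - exp (f $ i - f $ j) else exp (f $ i - f $ j)) \<and>
        cosh (len d f i j) = cosh_len_rhs B \<eta> f i j) \<and>
     (\<forall>t\<in>F. all_A3 B t \<or> type_III_face F B \<eta> d t)"

text \<open>Here \<open>i\<close> is the distinguished component.\<close>

definition weight_condition :: "('n set \<Rightarrow> real) \<Rightarrow> 'n \<Rightarrow> 'n \<Rightarrow> 'n \<Rightarrow> bool" where
  "weight_condition \<eta> i j k \<longleftrightarrow>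
     (\<eta> {j, k} > 0 \<and> \<eta> {i, j} > 0 \<and> \<eta> {i, k} > 0) \<or>
     (\<eta> {j, k} > 0 \<and> \<eta> {i, j} > 0 \<and> \<eta> {i, k} \<le> 0 \<and> \<eta> {j, k} + \<eta> {i, k} \<le> 0) \<or>
     (\<eta> {j, k} > 0 \<and> \<eta> {i, j} \<le> 0 \<and> \<eta> {i, k} > 0 \<and> \<eta> {j, k} + \<eta> {i, j} \<le> 0) \<or>
     (\<eta> {j, k} > 0 \<and> \<eta> {i, j} \<le> 0 \<and> \<eta> {i, k} \<le> 0 \<and>
       \<eta> {j, k} + \<eta> {i, j} \<le> 0 \<and> \<eta> {j, k} + \<eta> {i, k} \<le> 0)"

section \<open>Generalized combinatorial curvature\<close>

text \<open>
  The length $\theta_i^{jk}$ of the side at \<open>i\<close> of the right-angled hyperbolic hexagon. For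
  positive lengths the argument of \<open>arcosh\<close> exceeds 1, so that this is the positive
  solution of the hexagonal cosine law.
\<close>

definition theta :: "'n::finite edge_map \<Rightarrow> real ^ 'n \<Rightarrow> 'n \<Rightarrow> 'n \<Rightarrow> 'n \<Rightarrow> real" where
  "theta d f i j k =
     arcosh ((cosh (len d f j k) + cosh (len d f i j) * cosh (len d f i k)) /
             (sinh (len d f i j) * sinh (len d f i k)))"

text \<open>
  The sum runs over ordered pairs \<open>(j, k)\<close>, so that each face at \<open>i\<close> is counted
  twice; \<open>theta\<close> is symmetric in \<open>j\<close> and \<open>k\<close>.
\<close>

definition curvature ::
    "'n::finite set set \<Rightarrow> 'n edge_map \<Rightarrow> real ^ 'n \<Rightarrow> real ^ 'n" where
  "curvature F d f =
     (\<chi> i. (\<Sum>(j, k) \<in> {(j, k). {i, j, k} \<in> F}. theta d f i j k) / 2)"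

end

theory Submission
  imports Defs
begin

text \<open>
  Put $U_i = e^{-f_i}$, negated at the distinguished components of the Type-III hexagons. Then both
  kinds of edges satisfy $U_i U_j \cosh l_{ij} = \kappa_{ij} - (U_i^2 + U_j^2)/2$ with constants
  $\kappa_{ij}$, and on each hexagon the Jacobian of $\theta$ with respect to $U$ is symmetric: up to
  a positive factor it is a combination, with weights $1/U_i$, of three positive semidefinite forms,
  one for each side at a boundary component. This is positive definite when all weights are positive.
  On a Type-III hexagon one weight is negative, but the conditions $d_{ij}, d_{ik} < 0$ keep the
  weights inside the cone where definiteness persists. Since a vertex that is distinguished in one
  hexagon is distinguished in all hexagons around it, the signs of the $U_i$ are globally
  well-defined. In the coordinates $e^{-f_i}$ the admissible space is convex, and along a segment in it
  the pairing of the curvature with the direction of $U$ is strictly increasing.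
\<close>

section \<open>Right-angled hyperbolic hexagons\<close>


text \<open>
  Here \<open>a\<close>, \<open>b\<close>, \<open>c\<close> are the hyperbolic cosines of three pairwise
  non-adjacent sides; the side between those of \<open>b\<close> and \<open>c\<close> is computed.
\<close>

definition hex_side :: "real \<Rightarrow> real \<Rightarrow> real \<Rightarrow> real" where
  "hex_side a b c = arcosh ((a + b * c) / (sqrt (b\<^sup>2 - 1) * sqrt (c\<^sup>2 - 1)))"

text \<open>
  Minus the determinant of the Gram matrix with diagonal 1 and off-diagonal entries \<open>-a\<close>,
  \<open>-b\<close>, \<open>-c\<close>.
\<close>

definition hex_gram :: "real \<Rightarrow> real \<Rightarrow> real \<Rightarrow> real" where
  "hex_gram a b c = a\<^sup>2 + b\<^sup>2 + c\<^sup>2 + 2 * a * b * c - 1"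

lemma hex_gram_pos: "a > 1 \<Longrightarrow> b > 1 \<Longrightarrow> c > 1 \<Longrightarrow> hex_gram a b c > 0"
  unfolding hex_gram_def
  by (smt (verit) mult_pos_pos one_less_power pos2 zero_le_power2)

text \<open>The hyperbolic sine of the computed side, multiplied by those of the two adjacent sides,
  is the square root of \<open>hex_gram\<close>. As \<open>hex_gram\<close> is symmetric, the
  derivatives of all three computed sides share one denominator.\<close>

lemma hex_side_has_derivative:
  assumes a: "(a has_real_derivative a') (at t)"
    and b: "(b has_real_derivative b') (at t)"
    and c: "(c has_real_derivative c') (at t)"
    and gt1: "a t > 1" "b t > 1" "c t > 1"
  shows "((\<lambda>t. hex_side (a t) (b t) (c t)) has_real_derivative
    (a' - (c t + a t * b t) / ((b t)\<^sup>2 - 1) * b' - (b t + a t * c t) / ((c t)\<^sup>2 - 1) * c')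
      / sqrt (hex_gram (a t) (b t) (c t))) (at t)"
proof -
  define r where "r = sqrt ((b t)\<^sup>2 - 1)"
  define s where "s = sqrt ((c t)\<^sup>2 - 1)"
  have b2: "(b t)\<^sup>2 > 1" and c2: "(c t)\<^sup>2 > 1" using gt1 by (simp_all add: one_less_power)
  have r: "r > 0" "r\<^sup>2 = (b t)\<^sup>2 - 1" and s: "s > 0" "s\<^sup>2 = (c t)\<^sup>2 - 1"
    using b2 c2 by (simp_all add: r_def s_def)
  define X where "X = (a t + b t * c t) / (r * s)"
  have G: "X\<^sup>2 - 1 = hex_gram (a t) (b t) (c t) / (r * s)\<^sup>2"
  proof -
    have "(a t + b t * c t)\<^sup>2 - (r * s)\<^sup>2 = hex_gram (a t) (b t) (c t)"
      unfolding power_mult_distrib r(2) s(2) hex_gram_def by algebra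
    then show ?thesis using r(1) s(1) by (simp add: X_def power_divide field_simps)
  qed
  have Gp: "hex_gram (a t) (b t) (c t) > 0" using gt1 by (rule hex_gram_pos)
  have X0: "X > 0" using r s gt1 by (auto simp: X_def intro!: divide_pos_pos add_pos_pos mult_pos_pos)
  have "X\<^sup>2 > 1" using G Gp r s by (smt (verit) divide_pos_pos mult_pos_pos zero_less_power)
  then have X1: "X > 1" using X0 by (smt (verit) power2_eq_square mult_le_one)
  have sq: "sqrt (X\<^sup>2 - 1) = sqrt (hex_gram (a t) (b t) (c t)) / (r * s)"
    unfolding G using r s by (simp add: real_sqrt_divide)
  have rd: "((\<lambda>t. sqrt ((b t)\<^sup>2 - 1)) has_real_derivative b t * b' / r) (at t)"
    using b2 by (auto intro!: derivative_eq_intros b simp: r_def field_simps)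
  have sd: "((\<lambda>t. sqrt ((c t)\<^sup>2 - 1)) has_real_derivative c t * c' / s) (at t)"
    using c2 by (auto intro!: derivative_eq_intros c simp: s_def field_simps)
  have "((\<lambda>t. (a t + b t * c t) / (sqrt ((b t)\<^sup>2 - 1) * sqrt ((c t)\<^sup>2 - 1))) has_real_derivative
      ((a' + (b' * c t + c' * b t)) * (r * s) -
        (a t + b t * c t) * (b t * b' / r * s + c t * c' / s * r)) / ((r * s) * (r * s))) (at t)"
    unfolding r_def s_def
    by (rule DERIV_divide DERIV_add DERIV_mult a b c rd[unfolded r_def] sd[unfolded s_def])+
       (use r s in \<open>simp add: r_def s_def\<close>)
  also have "((a' + (b' * c t + c' * b t)) * (r * s) -
        (a t + b t * c t) * (b t * b' / r * s + c t * c' / s * r)) / ((r * s) * (r * s))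
     = (a' + b' * (c t - (a t + b t * c t) * b t / r\<^sup>2) + c' * (b t - (a t + b t * c t) * c t / s\<^sup>2)) / (r * s)"
    using r(1) s(1) by (simp add: field_simps power2_eq_square)
  also have "c t - (a t + b t * c t) * b t / r\<^sup>2 = - ((c t + a t * b t) / ((b t)\<^sup>2 - 1))"
    unfolding r(2) using b2 by (simp add: field_simps power2_eq_square)
  also have "b t - (a t + b t * c t) * c t / s\<^sup>2 = - ((b t + a t * c t) / ((c t)\<^sup>2 - 1))"
    unfolding s(2) using c2 by (simp add: field_simps power2_eq_square)
  finally have Xd: "((\<lambda>t. (a t + b t * c t) / (sqrt ((b t)\<^sup>2 - 1) * sqrt ((c t)\<^sup>2 - 1))) has_real_derivative
     (a' - (c t + a t * b t) / ((b t)\<^sup>2 - 1) * b' - (b t + a t * c t) / ((c t)\<^sup>2 - 1) * c') / (r * s)) (at t)"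
    (is "(?X has_real_derivative ?D / _) _") by (simp add: algebra_simps)
  have Xt: "?X t = X" by (simp add: X_def r_def s_def)
  have "((\<lambda>t. arcosh (?X t)) has_real_derivative (1 / sqrt (X\<^sup>2 - 1)) * (?D / (r * s))) (at t)"
    by (rule DERIV_chain2[OF _ Xd]) (unfold Xt, rule arcosh_real_has_field_derivative[OF X1])
  moreover have "(1 / sqrt (X\<^sup>2 - 1)) * (?D / (r * s)) = ?D / sqrt (hex_gram (a t) (b t) (c t))"
    unfolding sq using r(1) s(1) by simp
  ultimately show ?thesis unfolding hex_side_def by (simp only:)
qed

text \<open>
  The contribution of the weight $1/U_1$ to the Jacobian form, where \<open>a\<close>, \<open>b\<close>,
  \<open>c\<close> are $\cosh l_{23}$, $\cosh l_{31}$, $\cosh l_{12}$. It has rank two.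
\<close>

definition corner_form :: "real \<Rightarrow> real \<Rightarrow> real \<Rightarrow> real \<Rightarrow> real \<Rightarrow> real \<Rightarrow> real" where
  "corner_form a b c x y z =
     (a + b * c) / (c\<^sup>2 - 1) * (y + c * x)\<^sup>2 - 2 * (y + c * x) * (z + b * x) +
     (a + b * c) / (b\<^sup>2 - 1) * (z + b * x)\<^sup>2"

section \<open>Positivity of the corner forms\<close>

lemma binary_form_pos:
  fixes p q :: real
  assumes "k > 0" "l > 0" "k * l > 1" "p \<noteq> 0 \<or> q \<noteq> 0"
  shows "k * p\<^sup>2 - 2 * p * q + l * q\<^sup>2 > 0"
proof -
  have *: "k * (k * p\<^sup>2 - 2 * p * q + l * q\<^sup>2) = (k * p - q)\<^sup>2 + (k * l - 1) * q\<^sup>2"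
    by (simp add: power2_eq_square algebra_simps)
  have "(k * p - q)\<^sup>2 + (k * l - 1) * q\<^sup>2 > 0"
  proof (cases "q = 0")
    case True
    then show ?thesis using assms by simp
  next
    case False
    then have "(k * l - 1) * q\<^sup>2 > 0" using assms by simp
    then show ?thesis by (smt (verit) zero_le_power2)
  qed
  then show ?thesis using * assms(1) by (metis zero_less_mult_pos)
qed

text \<open>This is a binary form in \<open>y + c * x\<close> and \<open>z + b * x\<close>. Its
  discriminant condition is \<open>hex_gram a b c > 0\<close>, because \<open>hex_gram a b c\<close>
  is the square of \<open>a + b * c\<close> minus the product of \<open>b^2 - 1\<close> and
  \<open>c^2 - 1\<close>.\<close>

lemma corner_form_pos:
  assumes "a > 1" "b > 1" "c > 1" "y + c * x \<noteq> 0 \<or> z + b * x \<noteq> 0"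
  shows "corner_form a b c x y z > 0"
proof -
  have b2: "b\<^sup>2 > 1" and c2: "c\<^sup>2 > 1" using assms by (simp_all add: one_less_power)
  have m: "a + b * c > 0" using assms by (simp add: add_pos_pos)
  have "(a + b * c) * (a + b * c) - (c\<^sup>2 - 1) * (b\<^sup>2 - 1) = hex_gram a b c"
    by (simp add: hex_gram_def power2_eq_square algebra_simps)
  then have "(a + b * c) * (a + b * c) > (c\<^sup>2 - 1) * (b\<^sup>2 - 1)"
    using hex_gram_pos[OF assms(1-3)] by linarith
  then have "(a + b * c) / (c\<^sup>2 - 1) * ((a + b * c) / (b\<^sup>2 - 1)) > 1"
    using b2 c2 by (simp add: less_divide_eq)
  then show ?thesis unfolding corner_form_def
    using assms(4) b2 c2 m by (intro binary_form_pos) auto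
qed

lemma corner_form_nonneg:
  assumes "a > 1" "b > 1" "c > 1"
  shows "corner_form a b c x y z \<ge> 0"
proof (cases "y + c * x \<noteq> 0 \<or> z + b * x \<noteq> 0")
  case True
  then show ?thesis using corner_form_pos[OF assms True] by simp
next
  case False
  then show ?thesis by (simp add: corner_form_def)
qed

text \<open>
  The weights \<open>(-1, c, b)\<close> span the extreme ray of the cone of admissible weights with
  negative first entry; there the form degenerates to a form in \<open>y\<close> and \<open>z\<close>.
\<close>

lemma corner_form_boundary:
  assumes "a > 1" "b > 1" "c > 1"
  shows "c * corner_form b c a y z x + b * corner_form c a b z x y - corner_form a b c x y z =
    hex_gram a b c / (a\<^sup>2 - 1) * (a * y\<^sup>2 + a * z\<^sup>2 + 2 * y * z)"
proof -
  \<comment> \<open>Naming the reciprocals leaves a polynomial identity modulo three polynomial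
    relations, which is in the scope of \<open>algebra\<close>.\<close>
  define h where "h = 1 / (a\<^sup>2 - 1)"
  define i where "i = 1 / (b\<^sup>2 - 1)"
  define j where "j = 1 / (c\<^sup>2 - 1)"
  have "a\<^sup>2 > 1" "b\<^sup>2 > 1" "c\<^sup>2 > 1" using assms by (simp_all add: one_less_power)
  then have e: "h * (a\<^sup>2 - 1) = 1" "i * (b\<^sup>2 - 1) = 1" "j * (c\<^sup>2 - 1) = 1" by (simp_all add: h_def i_def j_def)
  have w: "w / (a\<^sup>2 - 1) = w * h" "w / (b\<^sup>2 - 1) = w * i" "w / (c\<^sup>2 - 1) = w * j" for w
    by (simp_all add: h_def i_def j_def)
  show ?thesis unfolding corner_form_def hex_gram_def w using e by algebra
qed


text \<open>For \<open>p < 0\<close> the weights split as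
  \<open>(p, q, r) = - p * (-1, c, b) + (0, c * p + q, b * p + r)\<close>. The first part
  contributes a nonnegative amount by \<open>corner_form_boundary\<close>. The second contributes a
  positive one, since the last two forms have no common nonzero kernel vector.\<close>

lemma corner_form_cyclic_sum_pos:
  assumes gt1: "a > 1" "b > 1" "c > 1"
    and w: "q > 0" "r > 0" "p > 0 \<or> (c * p + q > 0 \<and> b * p + r > 0)"
    and nz: "x \<noteq> 0 \<or> y \<noteq> 0 \<or> z \<noteq> 0"
  shows "p * corner_form a b c x y z + q * corner_form b c a y z x + r * corner_form c a b z x y > 0"
proof -
  let ?P = "corner_form a b c x y z" and ?Q = "corner_form b c a y z x"
    and ?R = "corner_form c a b z x y"
  have nn: "?P \<ge> 0" "?Q \<ge> 0" "?R \<ge> 0" using gt1 by (auto intro!: corner_form_nonneg)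
  have "?Q > 0 \<or> ?R > 0"
  proof (rule ccontr)
    assume "\<not> ?thesis"
    then have "z + a * y = 0" "x + c * y = 0" "x + b * z = 0" "y + a * z = 0"
      using corner_form_pos[OF gt1(2,3,1), of z y x] corner_form_pos[OF gt1(3,1,2), of x z y] by auto
    moreover have "a * a > 1" using gt1(1) by (simp add: less_1_mult)
    ultimately have "(a * a - 1) * y = 0" "a * a - 1 \<noteq> 0" by (algebra, simp)
    then have "y = 0" by simp
    with \<open>z + a * y = 0\<close> \<open>x + c * y = 0\<close> nz show False by simp
  qed
  then have QR: "\<alpha> * ?Q + \<beta> * ?R > 0" if "\<alpha> > 0" "\<beta> > 0" for \<alpha> \<beta>
    using that nn by (smt (verit) mult_nonneg_nonneg mult_pos_pos)
  show ?thesis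
  proof (cases "p \<ge> 0")
    case True
    then show ?thesis using QR[OF w(1,2)] nn(1) by (smt (verit) mult_nonneg_nonneg)
  next
    case False
    then have w': "c * p + q > 0" "b * p + r > 0" using w by auto
    have y2: "a * y\<^sup>2 + a * z\<^sup>2 + 2 * y * z = (a - 1) * (y\<^sup>2 + z\<^sup>2) + (y + z)\<^sup>2"
      by (simp add: power2_eq_square algebra_simps)
    have "a * y\<^sup>2 + a * z\<^sup>2 + 2 * y * z \<ge> 0" unfolding y2 using gt1 by simp
    then have "c * ?Q + b * ?R - ?P \<ge> 0"
      unfolding corner_form_boundary[OF gt1] using gt1 hex_gram_pos[OF gt1]
      by (simp add: one_less_power less_imp_le)
    then have "(- p) * (c * ?Q + b * ?R - ?P) \<ge> 0" using False by (intro mult_nonneg_nonneg) auto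
    moreover have "p * ?P + q * ?Q + r * ?R
        = (- p) * (c * ?Q + b * ?R - ?P) + ((c * p + q) * ?Q + (b * p + r) * ?R)"
      by (simp add: algebra_simps)
    ultimately show ?thesis using QR[OF w'] by linarith
  qed
qed

text \<open>If \<open>p\<close>, \<open>q\<close>, \<open>r\<close> are the reciprocals of vertex
  coordinates moving with velocities \<open>x\<close>, \<open>y\<close>, \<open>z\<close>, then
  \<open>a'\<close>, \<open>b'\<close>, \<open>c'\<close> are the velocities of the three cosines,
  as in \<open>cosh_side_has_derivative\<close>. The left side is then the derivative of the hexagon
  pairing times the square root of \<open>hex_gram\<close>. Both sides are linear in
  \<open>p\<close>, \<open>q\<close>, \<open>r\<close>.\<close>

lemma hex_form_eq:
  fixes a b c x y z p q r :: real
  defines "a' \<equiv> - ((a * q + r) * y + (a * r + q) * z)"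
    and "b' \<equiv> - ((b * r + p) * z + (b * p + r) * x)"
    and "c' \<equiv> - ((c * p + q) * x + (c * q + p) * y)"
  assumes "a > 1" "b > 1" "c > 1"
  shows "x * (a' - (c + a * b) / (b\<^sup>2 - 1) * b' - (b + a * c) / (c\<^sup>2 - 1) * c') +
      y * (b' - (a + b * c) / (c\<^sup>2 - 1) * c' - (c + b * a) / (a\<^sup>2 - 1) * a') +
      z * (c' - (b + c * a) / (a\<^sup>2 - 1) * a' - (a + c * b) / (b\<^sup>2 - 1) * b')
    = p * corner_form a b c x y z + q * corner_form b c a y z x + r * corner_form c a b z x y"
proof -
  define h where "h = 1 / (a\<^sup>2 - 1)"
  define i where "i = 1 / (b\<^sup>2 - 1)"
  define j where "j = 1 / (c\<^sup>2 - 1)"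
  have "a\<^sup>2 > 1" "b\<^sup>2 > 1" "c\<^sup>2 > 1" using assms by (simp_all add: one_less_power)
  then have e: "h * (a\<^sup>2 - 1) = 1" "i * (b\<^sup>2 - 1) = 1" "j * (c\<^sup>2 - 1) = 1" by (simp_all add: h_def i_def j_def)
  have w: "w / (a\<^sup>2 - 1) = w * h" "w / (b\<^sup>2 - 1) = w * i" "w / (c\<^sup>2 - 1) = w * j" for w
    by (simp_all add: h_def i_def j_def)
  show ?thesis unfolding corner_form_def a'_def b'_def c'_def w using e by algebra
qed

section \<open>Monotonicity of the hexagon pairing along affine paths\<close>

text \<open>The relation \<open>u * v * cosh l = k - (u^2 + v^2) / 2\<close> solved for
  \<open>cosh l\<close>. Admitting negative \<open>u\<close> or \<open>v\<close> lets one formula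
  serve both kinds of edges.\<close>

definition cosh_side :: "real \<Rightarrow> real \<Rightarrow> real \<Rightarrow> real" where
  "cosh_side k u v = k / (u * v) - (u / v + v / u) / 2"

lemma cosh_side_has_derivative:
  assumes u: "(u has_real_derivative x) (at t)" and v: "(v has_real_derivative y) (at t)"
    and nz: "u t \<noteq> 0" "v t \<noteq> 0"
  shows "((\<lambda>t. cosh_side k (u t) (v t)) has_real_derivative
    - ((cosh_side k (u t) (v t) * (1 / u t) + 1 / v t) * x +
       (cosh_side k (u t) (v t) * (1 / v t) + 1 / u t) * y)) (at t)"
proof -
  have "((\<lambda>t. cosh_side k (u t) (v t)) has_real_derivative
     - (k * (x * v t + u t * y) / (u t * v t)\<^sup>2)
     - ((x * v t - u t * y) / (v t)\<^sup>2 + (y * u t - v t * x) / (u t)\<^sup>2) / 2) (at t)"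
    unfolding cosh_side_def using nz
    by (auto intro!: derivative_eq_intros u v simp: power2_eq_square field_simps)
  also have "- (k * (x * v t + u t * y) / (u t * v t)\<^sup>2)
     - ((x * v t - u t * y) / (v t)\<^sup>2 + (y * u t - v t * x) / (u t)\<^sup>2) / 2 =
     - ((cosh_side k (u t) (v t) * (1 / u t) + 1 / v t) * x +
       (cosh_side k (u t) (v t) * (1 / v t) + 1 / u t) * y)"
    unfolding cosh_side_def using nz by (simp add: field_simps power2_eq_square)
  finally show ?thesis .
qed

text \<open>The derivative is the weighted sum of corner forms with weights \<open>1 / u t\<close>,
  \<open>1 / v t\<close>, \<open>1 / w t\<close>, divided by the square root of
  \<open>hex_gram\<close>. Only \<open>u\<close> may be negative, and then \<open>cone\<close> is
  the weight condition of \<open>corner_form_cyclic_sum_pos\<close>.\<close>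

lemma hex_pairing_strict_increasing:
  fixes u v w :: "real \<Rightarrow> real"
  assumes deriv: "\<And>t. (u has_real_derivative x) (at t)" "\<And>t. (v has_real_derivative y) (at t)"
      "\<And>t. (w has_real_derivative z) (at t)"
    and sgn: "\<And>t. 0 \<le> t \<Longrightarrow> t \<le> 1 \<Longrightarrow> u t \<noteq> 0 \<and> v t > 0 \<and> w t > 0"
    and gt1: "\<And>t. 0 \<le> t \<Longrightarrow> t \<le> 1 \<Longrightarrow>
      cosh_side k (v t) (w t) > 1 \<and> cosh_side l (w t) (u t) > 1 \<and> cosh_side m (u t) (v t) > 1"
    and cone: "\<And>t. 0 \<le> t \<Longrightarrow> t \<le> 1 \<Longrightarrow> u t > 0 \<or>
      (cosh_side m (u t) (v t) * (1 / u t) + 1 / v t > 0 \<and>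
       cosh_side l (w t) (u t) * (1 / u t) + 1 / w t > 0)"
    and nz: "x \<noteq> 0 \<or> y \<noteq> 0 \<or> z \<noteq> 0"
  defines "A \<equiv> \<lambda>t. cosh_side k (v t) (w t)" and "B \<equiv> \<lambda>t. cosh_side l (w t) (u t)"
    and "C \<equiv> \<lambda>t. cosh_side m (u t) (v t)"
  defines "\<psi> \<equiv> \<lambda>t. x * hex_side (A t) (B t) (C t) + y * hex_side (B t) (C t) (A t)
     + z * hex_side (C t) (A t) (B t)"
  shows "\<psi> 0 < \<psi> 1"
proof (rule DERIV_pos_imp_increasing[where f = \<psi>])
  fix t :: real assume t: "0 \<le> t" "t \<le> 1"
  define p q r where "p = 1 / u t" and "q = 1 / v t" and "r = 1 / w t"
  have s: "u t \<noteq> 0" "v t \<noteq> 0" "w t \<noteq> 0" "q > 0" "r > 0" and pu: "p > 0 \<longleftrightarrow> u t > 0"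
    using sgn[OF t] by (auto simp: p_def q_def r_def)
  have g: "A t > 1" "B t > 1" "C t > 1" using gt1[OF t] by (auto simp: A_def B_def C_def)
  define a' b' c' where "a' = - ((A t * q + r) * y + (A t * r + q) * z)"
    and "b' = - ((B t * r + p) * z + (B t * p + r) * x)"
    and "c' = - ((C t * p + q) * x + (C t * q + p) * y)"
  have da: "(A has_real_derivative a') (at t)" and db: "(B has_real_derivative b') (at t)"
    and dc: "(C has_real_derivative c') (at t)"
    unfolding A_def B_def C_def a'_def b'_def c'_def p_def q_def r_def
    by (intro cosh_side_has_derivative deriv s)+
  define G where "G = sqrt (hex_gram (A t) (B t) (C t))"
  have G0: "G > 0" unfolding G_def using hex_gram_pos[OF g] by simp
  have Gs: "sqrt (hex_gram (B t) (C t) (A t)) = G" "sqrt (hex_gram (C t) (A t) (B t)) = G"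
    by (simp_all add: G_def hex_gram_def algebra_simps)
  define D where "D = p * corner_form (A t) (B t) (C t) x y z +
     q * corner_form (B t) (C t) (A t) y z x + r * corner_form (C t) (A t) (B t) z x y"
  have D0: "D > 0" unfolding D_def
    using cone[OF t] pu s nz g
    by (intro corner_form_cyclic_sum_pos) (auto simp: p_def q_def r_def B_def C_def)
  note d1 = hex_side_has_derivative[OF da db dc g, folded G_def]
  note d2 = hex_side_has_derivative[OF db dc da g(2,3,1), unfolded Gs]
  note d3 = hex_side_has_derivative[OF dc da db g(3,1,2), unfolded Gs]
  have "(\<psi> has_real_derivative D / G) (at t)"
    unfolding \<psi>_def D_def hex_form_eq[OF g, symmetric]
    by (rule DERIV_cong, (rule DERIV_add DERIV_cmult d1 d2 d3)+)
       (simp add: a'_def b'_def c'_def add_divide_distrib)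
  then show "\<exists>D. (\<psi> has_real_derivative D) (at t) \<and> D > 0" using D0 G0 by auto
qed simp

section \<open>The structure in the coordinates $e^{-f_i}$\<close>


lemma theta_eq_hex_side:
  assumes "len d f i j > 0" "len d f i k > 0"
  shows "theta d f i j k = hex_side (cosh (len d f j k)) (cosh (len d f i k)) (cosh (len d f i j))"
proof -
  have "sinh x = sqrt ((cosh x)\<^sup>2 - 1)" if "x > 0" for x :: real
    using that by (simp add: cosh_square_eq)
  then show ?thesis using assms unfolding theta_def hex_side_def by (simp add: mult.commute)
qed

lemma len_commute: "len d f i j = len d f j i"
  by (simp add: len_def)

lemma cosh_diff_exp: "cosh (b - a) = (exp (- a) / exp (- b) + exp (- b) / exp (- a)) / 2" for a b :: real
  by (simp add: cosh_def exp_diff exp_minus field_simps)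

lemma exp_add_inverse: "exp (a + b) = 1 / (exp (- a) * exp (- b))" for a b :: real
  by (simp add: exp_add exp_minus field_simps)

text \<open>Negating one endpoint flips both terms of \<open>cosh_side\<close>. Negating the
  constant as well restores the first, so only the sign of the cosine of the difference
  changes.\<close>

lemma cosh_len_rhs_eq_cosh_side:
  "cosh_len_rhs B \<eta> f i j =
    (if {i, j} \<in> B then cosh_side (- \<eta> {i, j}) (- exp (- f $ i)) (exp (- f $ j))
     else cosh_side (\<eta> {i, j}) (exp (- f $ i)) (exp (- f $ j)))"
  by (auto simp: cosh_len_rhs_def cosh_side_def cosh_diff_exp exp_add_inverse field_simps)

lemma cosh_len_rhs_commute: "cosh_len_rhs B \<eta> f i j = cosh_len_rhs B \<eta> f j i"
  by (simp add: cosh_len_rhs_def insert_commute add.commute cosh_diff_exp)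

text \<open>Clearing the positive denominator turns admissibility into a bound on the square of a
  linear form in the coordinates \<open>exp (- f $ i)\<close>, which can be followed along
  segments.\<close>

lemma cosh_len_rhs_gt_1_iff:
  "cosh_len_rhs B \<eta> f i j > 1 \<longleftrightarrow>
    (if {i, j} \<in> B then (exp (- f $ i) - exp (- f $ j))\<^sup>2 > - 2 * \<eta> {i, j}
     else (exp (- f $ i) + exp (- f $ j))\<^sup>2 < 2 * \<eta> {i, j})"
proof -
  define u v where "u = exp (- f $ i)" and "v = exp (- f $ j)"
  have pos: "u > 0" "v > 0" "u * v > 0" by (simp_all add: u_def v_def)
  have "(u / v + v / u) / 2 + k / (u * v) - 1 = ((u - v)\<^sup>2 + 2 * k) / (2 * (u * v))"
    and "- ((u / v + v / u) / 2) + k / (u * v) - 1 = (2 * k - (u + v)\<^sup>2) / (2 * (u * v))" for k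
    using pos by (simp_all add: field_simps power2_eq_square)
  then have "(u / v + v / u) / 2 + k / (u * v) > 1 \<longleftrightarrow> ((u - v)\<^sup>2 + 2 * k) / (2 * (u * v)) > 0"
    and "- ((u / v + v / u) / 2) + k / (u * v) > 1 \<longleftrightarrow> (2 * k - (u + v)\<^sup>2) / (2 * (u * v)) > 0" for k
    by (metis diff_gt_0_iff_gt)+
  then show ?thesis
    using pos by (auto simp: cosh_len_rhs_def cosh_diff_exp exp_add_inverse zero_less_divide_iff
        simp flip: u_def v_def)
qed

text \<open>The path from \<open>f\<close> to \<open>g\<close> that is a segment in the coordinates $e^{-f_i}$.\<close>

definition log_segment :: "real ^ 'n::finite \<Rightarrow> real ^ 'n \<Rightarrow> real \<Rightarrow> real ^ 'n" where
  "log_segment f g t = (\<chi> i. - ln (exp (- f $ i) + t * (exp (- g $ i) - exp (- f $ i))))"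

lemma segment_bounds:
  fixes a b t :: real
  assumes "0 \<le> t" "t \<le> 1"
  shows "min a b \<le> a + t * (b - a)" "a + t * (b - a) \<le> max a b"
proof -
  have "t * (b - a) \<le> 1 * (b - a)" if "a \<le> b" using that assms by (intro mult_right_mono) auto
  moreover have "t * (a - b) \<le> 1 * (a - b)" if "b \<le> a" using that assms by (intro mult_right_mono) auto
  moreover have "0 \<le> t * (b - a)" if "a \<le> b" using that assms by simp
  moreover have "0 \<le> t * (a - b)" if "b \<le> a" using that assms by simp
  ultimately show "min a b \<le> a + t * (b - a)" "a + t * (b - a) \<le> max a b"
    by (auto simp: min_def max_def algebra_simps)
qed

text \<open>The restriction on \<open>t\<close> keeps the argument of \<open>ln\<close> positive, so
  that \<open>exp\<close> undoes it.\<close>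

lemma exp_log_segment:
  assumes "0 \<le> t" "t \<le> 1"
  shows "exp (- log_segment f g t $ i) = exp (- f $ i) + t * (exp (- g $ i) - exp (- f $ i))"
proof -
  have "0 < min (exp (- f $ i)) (exp (- g $ i))" by simp
  then have "exp (- f $ i) + t * (exp (- g $ i) - exp (- f $ i)) > 0"
    using segment_bounds(1)[OF assms] by (rule less_le_trans)
  then show ?thesis by (simp add: log_segment_def)
qed

lemma log_segment_ends: "log_segment f g 0 = f" "log_segment f g 1 = g"
  by (simp_all add: log_segment_def vec_eq_iff)

section \<open>Surfaces with a mixed structure\<close>

locale mixed_surface =
  fixes F B :: "'n::finite set set" and \<eta> :: "'n set \<Rightarrow> real" and d :: "'n edge_map"
  assumes triangulated: "triangulated_closed_surface F"
    and mixed: "mixed_structure_III F B \<eta> d"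
begin

abbreviation \<Omega> :: "(real ^ 'n) set" where "\<Omega> \<equiv> admissible_space F B \<eta>"

abbreviation type3 :: "'n \<Rightarrow> 'n \<Rightarrow> 'n \<Rightarrow> bool" where "type3 \<equiv> type_III F B \<eta> d"

definition apex :: "'n \<Rightarrow> bool" where "apex v \<longleftrightarrow> (\<exists>j k. type3 v j k)"

definition sgn_apex :: "'n \<Rightarrow> real" where "sgn_apex v = (if apex v then - 1 else 1)"

section \<open>Faces, edges and distinguished components\<close>

lemma face_distinct:
  assumes "{i, j, k} \<in> F"
  shows "i \<noteq> j" "j \<noteq> k" "i \<noteq> k"
proof -
  have "card {i, j, k} = 3"
    using triangulated assms unfolding triangulated_closed_surface_def by blast
  then show "i \<noteq> j" "j \<noteq> k" "i \<noteq> k" by (auto simp: card_insert_if split: if_splits)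
qed

lemma face_edges:
  assumes "{i, j, k} \<in> F"
  shows "{i, j} \<in> edges F" "{j, k} \<in> edges F" "{k, i} \<in> edges F"
  using assms face_distinct[OF assms] unfolding edges_def
  by (auto intro!: bexI[of _ "{i, j, k}"])

lemma edge_face:
  assumes "{i, j} \<in> edges F"
  obtains k where "{i, j, k} \<in> F"
proof -
  obtain t where t: "card {i, j} = 2" "t \<in> F" "{i, j} \<subseteq> t" using assms by (auto simp: edges_def)
  have "card t = 3" using t(2) triangulated by (simp add: triangulated_closed_surface_def)
  then have "card (t - {i, j}) = 1" using t by (simp add: card_Diff_subset)
  then obtain k where "t - {i, j} = {k}" by (auto simp: card_1_singleton_iff)
  then have "t = {i, j, k}" using t(3) by auto
  then show ?thesis using t(2) that by blast
qed

lemma edge_len: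
  assumes "f \<in> \<Omega>" "{i, j} \<in> edges F"
  shows "len d f i j > 0" "cosh (len d f i j) = cosh_len_rhs B \<eta> f i j"
    "sinh (d f i j) / sinh (d f j i) =
       (if {i, j} \<in> B then - exp (f $ i - f $ j) else exp (f $ i - f $ j))"
  using mixed assms unfolding mixed_structure_III_def discrete_conformal_structure_def by blast+

lemma type3_swap: "type3 i j k \<Longrightarrow> type3 i k j"
  by (auto simp: type_III_def insert_commute)

lemma type3_faceD: "type3 i j k \<Longrightarrow> {i, j, k} \<in> F"
  by (simp add: type_III_def)

text \<open>Only the three rotations of the labelling are needed; \<open>type3_swap\<close> absorbs
  the reflections.\<close>

lemma face_cases:
  assumes "{i, j, k} \<in> F"
  obtains "{i, j} \<notin> B" "{j, k} \<notin> B" "{k, i} \<notin> B" | "type3 i j k" | "type3 j k i" | "type3 k i j"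
proof -
  note dist = face_distinct[OF assms]
  consider "all_A3 B {i, j, k}" | "type_III_face F B \<eta> d {i, j, k}"
    using mixed assms unfolding mixed_structure_III_def by blast
  then show thesis
  proof cases
    case 1
    then show thesis using that(1) dist unfolding all_A3_def by (simp add: insert_commute)
  next
    case 2
    then obtain a b c where eq: "{i, j, k} = {a, b, c}" and t: "type3 a b c"
      unfolding type_III_face_def by blast
    have "a \<noteq> b" "b \<noteq> c" "a \<noteq> c" using type3_faceD[OF t] face_distinct by blast+
    moreover have "a \<in> {i, j, k}" "b \<in> {i, j, k}" "c \<in> {i, j, k}" using eq by auto
    ultimately show thesis using t that(2-4) type3_swap[OF t] by auto
  qed
qed

lemma type3_signs:
  assumes "type3 i j k" "f \<in> \<Omega>"
  shows "d f i j < 0" "d f i k < 0" "d f j i > 0" "d f k i > 0"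
  using assms by (auto simp: type_III_def)

lemma type3_B:
  assumes "type3 i j k"
  shows "{i, j} \<in> B" "{j, i} \<in> B" "{i, k} \<in> B" "{k, i} \<in> B" "{j, k} \<notin> B" "{k, j} \<notin> B"
  using assms by (auto simp: type_III_def insert_commute)

text \<open>If \<open>b\<close> were the distinguished component, the edge opposite to it,
  \<open>{v, a}\<close>, would be of kind (A3).\<close>

lemma B_edge_type3:
  assumes "{v, a, b} \<in> F" "{v, a} \<in> B"
  shows "type3 v a b \<or> type3 a v b"
  using assms(1)
proof (cases rule: face_cases)
  case 4
  then show ?thesis using assms(2) type3_B(5) by blast
qed (use assms(2) type3_swap in auto)

text \<open>Being distinguished propagates around a vertex because its link is connected.\<close>

lemma apex_face:
  assumes "f \<in> \<Omega>" "apex v" "{v, a, b} \<in> F"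
  shows "type3 v a b"
proof -
  \<comment> \<open>The edge \<open>{v, x}\<close> is of kind (B3), so the face
    \<open>{v, x, y}\<close> is distinguished at \<open>v\<close> or at \<open>x\<close>. The latter
    would give \<open>d f v x > 0\<close>, whereas the known face gives \<open>d f v x < 0\<close>.
    An admissible \<open>f\<close> is needed to compare these signs.\<close>
  have step: "type3 v x y" if "type3 v x c" "{v, x, y} \<in> F" for x y c
    using B_edge_type3[OF that(2) type3_B(1)[OF that(1)]] type3_signs[OF _ assms(1)] that(1)
    by fastforce
  obtain j k where jk: "type3 v j k" using assms(2) by (auto simp: apex_def)
  have "(j, a) \<in> (link_rel F v)\<^sup>*"
    using triangulated face_edges(1)[OF type3_faceD[OF jk]] face_edges(1)[OF assms(3)]
    unfolding triangulated_closed_surface_def by blast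
  then have "\<exists>c. type3 v a c"
  proof (induction rule: rtrancl_induct)
    case base
    then show ?case using jk by blast
  next
    case (step x y)
    then show ?case using \<open>\<And>x y c. type3 v x c \<Longrightarrow> {v, x, y} \<in> F \<Longrightarrow> type3 v x y\<close> type3_swap
      unfolding link_rel_def by blast
  qed
  then show ?thesis using step assms(3) by blast
qed

text \<open>If \<open>j\<close> or \<open>k\<close> were distinguished in some face,
  \<open>apex_face\<close> would make it distinguished in this one, forcing the edge
  \<open>{j, k}\<close> into \<open>B\<close>.\<close>

lemma type3_sgn_apex:
  assumes "f \<in> \<Omega>" "type3 i j k"
  shows "sgn_apex i = - 1" "sgn_apex j = 1" "sgn_apex k = 1"
proof -
  note F = type3_faceD[OF assms(2)]
  show "sgn_apex i = - 1" using assms(2) by (auto simp: sgn_apex_def apex_def)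
  have "\<not> apex j"
    using apex_face[OF assms(1), of j i k] F type3_B(3)[of j i k] type3_B(5)[OF assms(2)]
    by (auto simp: insert_commute)
  moreover have "\<not> apex k"
    using apex_face[OF assms(1), of k i j] F type3_B(3)[of k i j] type3_B(6)[OF assms(2)]
    by (auto simp: insert_commute)
  ultimately show "sgn_apex j = 1" "sgn_apex k = 1" by (auto simp: sgn_apex_def)
qed

lemma A3_sgn_apex:
  assumes "f \<in> \<Omega>" "{i, j, k} \<in> F" "{i, j} \<notin> B" "{j, k} \<notin> B" "{k, i} \<notin> B"
  shows "sgn_apex i = 1" "sgn_apex j = 1" "sgn_apex k = 1"
proof -
  have "\<not> apex i" using apex_face[OF assms(1), of i j k] assms(2,3) type3_B(1)[of i j k]
    by blast
  moreover have "\<not> apex j" using apex_face[OF assms(1), of j k i] assms(2,4) type3_B(1)[of j k i]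
    by (auto simp: insert_commute)
  moreover have "\<not> apex k" using apex_face[OF assms(1), of k i j] assms(2,5) type3_B(1)[of k i j]
    by (auto simp: insert_commute)
  ultimately show "sgn_apex i = 1" "sgn_apex j = 1" "sgn_apex k = 1"
    by (auto simp: sgn_apex_def)
qed

section \<open>Inequalities at a distinguished component and convexity\<close>

text \<open>Expanding \<open>sinh ((q - p) + p)\<close> shows that
  \<open>cosh (q - p) * sinh p\<close> is less than \<open>sinh q\<close>, and the sine ratio of a
  (B3) edge turns this into the claim. With \<open>exp (- f $ i)\<close> negated it is the cone
  condition of \<open>hex_pairing_strict_increasing\<close>.\<close>

lemma apex_dominates:
  assumes "f \<in> \<Omega>" "type3 i j k"
  shows "cosh_len_rhs B \<eta> f i j * exp (- f $ j) < exp (- f $ i)"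
proof -
  define p q where "p = - d f i j" and "q = d f j i"
  have pq: "p > 0" "q > 0" using type3_signs[OF assms(2,1)] by (auto simp: p_def q_def)
  have e: "{i, j} \<in> edges F" using face_edges type3_faceD assms(2) by blast
  note l = edge_len[OF assms(1) e]
  have len: "len d f i j = q - p" by (simp add: len_def p_def q_def)
  have "sinh p / sinh q = exp (f $ i - f $ j)"
    using l(3) type3_B(1)[OF assms(2)] by (simp add: p_def q_def)
  then have r: "sinh p * exp (- f $ i) = sinh q * exp (- f $ j)"
    using pq by (simp add: field_simps exp_diff exp_minus)
  have "sinh q = sinh (q - p) * cosh p + cosh (q - p) * sinh p"
    by (metis diff_add_cancel sinh_add)
  moreover have "sinh (q - p) > 0" using l(1) len by simp
  ultimately have "cosh (q - p) * sinh p < sinh q" by simp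
  then have "cosh (q - p) * sinh p * exp (- f $ j) < sinh q * exp (- f $ j)" by simp
  then have "sinh p * (cosh (q - p) * exp (- f $ j)) < sinh p * exp (- f $ i)"
    unfolding r by (simp add: ac_simps)
  then show ?thesis using pq l(2) len by simp
qed

lemma admissible_gt_1:
  assumes "f \<in> \<Omega>" "{i, j} \<in> edges F"
  shows "cosh_len_rhs B \<eta> f i j > 1"
  using assms by (simp add: admissible_space_def)

lemma apex_exp_less:
  assumes "f \<in> \<Omega>" "type3 i j k"
  shows "exp (- f $ j) < exp (- f $ i)"
proof -
  have "cosh_len_rhs B \<eta> f i j > 1"
    using admissible_gt_1 assms face_edges type3_faceD by blast
  then have "1 * exp (- f $ j) < cosh_len_rhs B \<eta> f i j * exp (- f $ j)"
    by (intro mult_strict_right_mono) auto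
  then show ?thesis using apex_dominates[OF assms] by linarith
qed

text \<open>
  Since $e^{-f_i} > e^{-f_j}$ on the edges of kind (B3) at a distinguished component \<open>i\<close>, only
  one branch of $(e^{-f_i} - e^{-f_j})^2 > -2\eta_{ij}$ occurs.
\<close>

lemma log_segment_admissible:
  assumes f: "f \<in> \<Omega>" and g: "g \<in> \<Omega>" and t: "0 \<le> t" "t \<le> 1"
  shows "log_segment f g t \<in> \<Omega>"
  unfolding admissible_space_def
proof (intro CollectI allI impI)
  have B: "cosh_len_rhs B \<eta> (log_segment f g t) i j > 1" if "type3 i j k" for i j k
  proof -
    \<comment> \<open>The difference of the two coordinates is affine in \<open>t\<close> and
      positive at both ends by \<open>apex_exp_less\<close>, so its square is at least that of the
      smaller end value.\<close>
    note bd = segment_bounds(1)[OF t, of "exp (- f $ i) - exp (- f $ j)" "exp (- g $ i) - exp (- g $ j)"]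
    have e: "{i, j} \<in> edges F" using that type3_faceD face_edges by blast
    have "(exp (- f $ i) - exp (- f $ j))\<^sup>2 > - 2 * \<eta> {i, j}"
      "(exp (- g $ i) - exp (- g $ j))\<^sup>2 > - 2 * \<eta> {i, j}"
      using admissible_gt_1[OF f e] admissible_gt_1[OF g e] type3_B(1)[OF that]
      by (simp_all add: cosh_len_rhs_gt_1_iff)
    then have "- 2 * \<eta> {i, j} < (min (exp (- f $ i) - exp (- f $ j)) (exp (- g $ i) - exp (- g $ j)))\<^sup>2"
      by (auto simp: min_def)
    also have "\<dots> \<le> (exp (- log_segment f g t $ i) - exp (- log_segment f g t $ j))\<^sup>2"
      using bd apex_exp_less[OF f that] apex_exp_less[OF g that]
      by (intro power_mono) (auto simp: exp_log_segment[OF t] algebra_simps)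
    finally show ?thesis using type3_B(1)[OF that] by (simp add: cosh_len_rhs_gt_1_iff)
  qed
  fix i j assume e: "{i, j} \<in> edges F"
  then obtain k where k: "{i, j, k} \<in> F" by (rule edge_face)
  show "cosh_len_rhs B \<eta> (log_segment f g t) i j > 1"
  proof (cases "{i, j} \<in> B")
    case True
    then show ?thesis using B_edge_type3[OF k True] B cosh_len_rhs_commute by metis
  next
    case False
    note bd = segment_bounds(2)[OF t, of "exp (- f $ i) + exp (- f $ j)" "exp (- g $ i) + exp (- g $ j)"]
    have "exp (- log_segment f g t $ i) + exp (- log_segment f g t $ j)
      \<le> max (exp (- f $ i) + exp (- f $ j)) (exp (- g $ i) + exp (- g $ j))"
      using bd by (simp add: exp_log_segment[OF t] algebra_simps)
    then have "(exp (- log_segment f g t $ i) + exp (- log_segment f g t $ j))\<^sup>2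
      \<le> (max (exp (- f $ i) + exp (- f $ j)) (exp (- g $ i) + exp (- g $ j)))\<^sup>2"
      by (intro power_mono) (simp_all add: add_nonneg_nonneg)
    also have "\<dots> < 2 * \<eta> {i, j}"
      using admissible_gt_1[OF f e] admissible_gt_1[OF g e] False
      by (auto simp: cosh_len_rhs_gt_1_iff max_def)
    finally show ?thesis using False by (simp add: cosh_len_rhs_gt_1_iff)
  qed
qed

section \<open>The curvature pairing and injectivity\<close>

definition face_pairing :: "('n \<Rightarrow> real) \<Rightarrow> real ^ 'n \<Rightarrow> 'n \<Rightarrow> 'n \<Rightarrow> 'n \<Rightarrow> real" where
  "face_pairing x f i j k =
     x i * theta d f i j k + x j * theta d f j k i + x k * theta d f k i j"

lemma face_pairing_rotate: "face_pairing x f i j k = face_pairing x f j k i"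
  by (simp add: face_pairing_def)

lemma face_pairing_eq:
  assumes "f \<in> \<Omega>" "{i, j, k} \<in> F"
  shows "face_pairing x f i j k =
    x i * hex_side (cosh_len_rhs B \<eta> f j k) (cosh_len_rhs B \<eta> f k i) (cosh_len_rhs B \<eta> f i j) +
    x j * hex_side (cosh_len_rhs B \<eta> f k i) (cosh_len_rhs B \<eta> f i j) (cosh_len_rhs B \<eta> f j k) +
    x k * hex_side (cosh_len_rhs B \<eta> f i j) (cosh_len_rhs B \<eta> f j k) (cosh_len_rhs B \<eta> f k i)"
proof -
  note e = face_edges[OF assms(2)]
  note l = edge_len(1)[OF assms(1) e(1)] edge_len(1)[OF assms(1) e(2)] edge_len(1)[OF assms(1) e(3)]
  note c = edge_len(2)[OF assms(1) e(1)] edge_len(2)[OF assms(1) e(2)] edge_len(2)[OF assms(1) e(3)]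
  show ?thesis
    unfolding face_pairing_def using l
    by (simp add: theta_eq_hex_side len_commute[of d f i k] len_commute[of d f j i]
        len_commute[of d f k j] flip: c)
qed

text \<open>Along \<open>log_segment f g\<close> the signed coordinates are affine with velocity
  \<open>x\<close>, so \<open>hex_pairing_strict_increasing\<close> applies to each face.\<close>

lemma face_pairing_less:
  assumes f: "f \<in> \<Omega>" and g: "g \<in> \<Omega>" and F: "{i, j, k} \<in> F"
    and nz: "x i \<noteq> 0 \<or> x j \<noteq> 0 \<or> x k \<noteq> 0"
    and x: "x = (\<lambda>v. sgn_apex v * (exp (- g $ v) - exp (- f $ v)))"
  shows "face_pairing x f i j k < face_pairing x g i j k"
proof -
  \<comment> \<open>The lemma on hexagons allows a negative coordinate only in first position. The
    remaining Type-III cases follow by rotating the face.\<close>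
  have main: "face_pairing x f i j k < face_pairing x g i j k"
    if F: "{i, j, k} \<in> F" and nz: "x i \<noteq> 0 \<or> x j \<noteq> 0 \<or> x k \<noteq> 0"
      and c: "type3 i j k \<or> {i, j} \<notin> B \<and> {j, k} \<notin> B \<and> {k, i} \<notin> B" for i j k
  proof -
    define U where "U v t = sgn_apex v * (exp (- f $ v) + t * (exp (- g $ v) - exp (- f $ v)))" for v t
    define \<kappa> where "\<kappa> e = (if e \<in> B then - \<eta> e else \<eta> e)" for e
    have U: "U v t = sgn_apex v * exp (- log_segment f g t $ v)" if "0 \<le> t" "t \<le> 1" for v t
      by (simp add: U_def exp_log_segment[OF that])
    have dU: "(U v has_real_derivative x v) (at t)" for v t
      unfolding U_def x by (auto intro!: derivative_eq_intros)
    have sg: "sgn_apex i = (if type3 i j k then - 1 else 1)" "sgn_apex j = 1" "sgn_apex k = 1"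
      using c type3_sgn_apex[OF f, of i j k] A3_sgn_apex[OF f F] type3_B(1)[of i j k] by auto
    have rhs: "cosh_len_rhs B \<eta> (log_segment f g t) i j = cosh_side (\<kappa> {i, j}) (U i t) (U j t)"
        "cosh_len_rhs B \<eta> (log_segment f g t) j k = cosh_side (\<kappa> {j, k}) (U j t) (U k t)"
        "cosh_len_rhs B \<eta> (log_segment f g t) k i = cosh_side (\<kappa> {k, i}) (U k t) (U i t)"
      if t: "0 \<le> t" "t \<le> 1" for t
      using c type3_B[of i j k] sg
      by (auto simp: cosh_len_rhs_eq_cosh_side U[OF t] \<kappa>_def cosh_side_def)
    have adm: "log_segment f g t \<in> \<Omega>" if "0 \<le> t" "t \<le> 1" for t
      using log_segment_admissible[OF f g that] .
    note less = hex_pairing_strict_increasing[OF dU[of i] dU[of j] dU[of k],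
        of "\<kappa> {j, k}" "\<kappa> {k, i}" "\<kappa> {i, j}"]
    have "x i * hex_side (cosh_side (\<kappa> {j, k}) (U j 0) (U k 0)) (cosh_side (\<kappa> {k, i}) (U k 0) (U i 0))
           (cosh_side (\<kappa> {i, j}) (U i 0) (U j 0)) +
         x j * hex_side (cosh_side (\<kappa> {k, i}) (U k 0) (U i 0)) (cosh_side (\<kappa> {i, j}) (U i 0) (U j 0))
           (cosh_side (\<kappa> {j, k}) (U j 0) (U k 0)) +
         x k * hex_side (cosh_side (\<kappa> {i, j}) (U i 0) (U j 0)) (cosh_side (\<kappa> {j, k}) (U j 0) (U k 0))
           (cosh_side (\<kappa> {k, i}) (U k 0) (U i 0))
       < x i * hex_side (cosh_side (\<kappa> {j, k}) (U j 1) (U k 1)) (cosh_side (\<kappa> {k, i}) (U k 1) (U i 1))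
           (cosh_side (\<kappa> {i, j}) (U i 1) (U j 1)) +
         x j * hex_side (cosh_side (\<kappa> {k, i}) (U k 1) (U i 1)) (cosh_side (\<kappa> {i, j}) (U i 1) (U j 1))
           (cosh_side (\<kappa> {j, k}) (U j 1) (U k 1)) +
         x k * hex_side (cosh_side (\<kappa> {i, j}) (U i 1) (U j 1)) (cosh_side (\<kappa> {j, k}) (U j 1) (U k 1))
           (cosh_side (\<kappa> {k, i}) (U k 1) (U i 1))"
    proof (rule less[OF _ _ _ nz])
      fix t :: real assume t: "0 \<le> t" "t \<le> 1"
      show "U i t \<noteq> 0 \<and> U j t > 0 \<and> U k t > 0" using sg by (simp add: U[OF t])
      show "cosh_side (\<kappa> {j, k}) (U j t) (U k t) > 1 \<and> cosh_side (\<kappa> {k, i}) (U k t) (U i t) > 1 \<and>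
          cosh_side (\<kappa> {i, j}) (U i t) (U j t) > 1"
        using face_edges[OF F] admissible_gt_1[OF adm[OF t]] by (simp flip: rhs[OF t])
      show "U i t > 0 \<or> (cosh_side (\<kappa> {i, j}) (U i t) (U j t) * (1 / U i t) + 1 / U j t > 0 \<and>
          cosh_side (\<kappa> {k, i}) (U k t) (U i t) * (1 / U i t) + 1 / U k t > 0)"
      proof (cases "type3 i j k")
        case True
        have "cosh_len_rhs B \<eta> (log_segment f g t) i j * (1 / U i t) + 1 / U j t > 0"
          "cosh_len_rhs B \<eta> (log_segment f g t) i k * (1 / U i t) + 1 / U k t > 0"
          using apex_dominates[OF adm[OF t] True] apex_dominates[OF adm[OF t] type3_swap[OF True]] sg True
          by (simp_all add: U[OF t] field_simps)
        then show ?thesis by (simp add: cosh_len_rhs_commute[of _ _ _ i k] rhs[OF t])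
      qed (simp add: U[OF t] sg)
    qed
    then show ?thesis
      using face_pairing_eq[OF f F] face_pairing_eq[OF g F] rhs[of 0] rhs[of 1]
      by (simp add: log_segment_ends)
  qed
  from F show ?thesis
  proof (cases rule: face_cases)
    case 1
    then show ?thesis using main[OF F nz] by blast
  next
    case 2
    then show ?thesis using main[OF F nz] by blast
  next
    case 3
    then have "face_pairing x f j k i < face_pairing x g j k i"
      using F nz by (intro main) (auto simp: insert_commute)
    then show ?thesis by (simp only: face_pairing_rotate[of _ _ i])
  next
    case 4
    then have "face_pairing x f k i j < face_pairing x g k i j"
      using F nz by (intro main) (auto simp: insert_commute)
    then show ?thesis by (simp only: face_pairing_rotate[of _ _ k])
  qed
qed

text \<open>Rotation permutes the ordered triples, so the three terms of \<open>face_pairing\<close>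
  have equal sums, giving a factor 3. The halving in \<open>curvature\<close> gives the factor
  2.\<close>

lemma curvature_pairing:
  "(\<Sum>i\<in>UNIV. x i * curvature F d f $ i) =
    (\<Sum>(i, j, k) | {i, j, k} \<in> F. face_pairing x f i j k) / 6"
proof -
  let ?T = "{(i, j, k). {i, j, k} \<in> F}"
  let ?\<theta> = "\<lambda>(i, j, k). x i * theta d f i j k"
  let ?\<rho> = "\<lambda>(i, j, k). (j, k, i)"
  have bij: "bij_betw ?\<rho> ?T ?T"
    by (rule bij_betw_byWitness[where f' = "\<lambda>(i, j, k). (k, i, j)"]) (auto simp: insert_commute)
  have r1: "sum ?\<theta> ?T = (\<Sum>p\<in>?T. ?\<theta> (?\<rho> p))" using sum.reindex_bij_betw[OF bij, of ?\<theta>] by simp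
  have r2: "(\<Sum>p\<in>?T. ?\<theta> (?\<rho> p)) = (\<Sum>p\<in>?T. ?\<theta> (?\<rho> (?\<rho> p)))"
    using sum.reindex_bij_betw[OF bij, of "\<lambda>p. ?\<theta> (?\<rho> p)"] by simp
  have "(\<Sum>p\<in>?T. case p of (i, j, k) \<Rightarrow> face_pairing x f i j k) =
      (\<Sum>p\<in>?T. ?\<theta> p + ?\<theta> (?\<rho> p) + ?\<theta> (?\<rho> (?\<rho> p)))"
    by (rule sum.cong) (auto simp: face_pairing_def)
  also have "\<dots> = 3 * sum ?\<theta> ?T"
    using r1 r2 by (simp add: sum.distrib)
  also have "sum ?\<theta> ?T = (\<Sum>i\<in>UNIV. \<Sum>(j, k) | {i, j, k} \<in> F. x i * theta d f i j k)"
  proof -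
    have "?T = (SIGMA i:UNIV. {(j, k). {i, j, k} \<in> F})" by auto
    then show ?thesis by (simp add: sum.Sigma split_def)
  qed
  also have "\<dots> = 2 * (\<Sum>i\<in>UNIV. x i * curvature F d f $ i)"
    unfolding sum_distrib_left[of 2]
    by (rule sum.cong) (simp_all add: curvature_def split_def flip: sum_distrib_left)
  finally show ?thesis by simp
qed

text \<open>Both curvatures are paired with the same \<open>x\<close>. Some face contains a vertex
  where \<open>f\<close> and \<open>g\<close> differ, and there the increase is strict.\<close>

lemma curvature_inj: "inj_on (curvature F d) \<Omega>"
proof (rule inj_onI, rule ccontr)
  fix f g assume f: "f \<in> \<Omega>" and g: "g \<in> \<Omega>" and K: "curvature F d f = curvature F d g" and "f \<noteq> g"
  define x where "x = (\<lambda>v. sgn_apex v * (exp (- g $ v) - exp (- f $ v)))"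
  note less = face_pairing_less[OF f g _ _ x_def]
  obtain v where "f $ v \<noteq> g $ v" using \<open>f \<noteq> g\<close> by (auto simp: vec_eq_iff)
  moreover have "sgn_apex v \<noteq> 0" by (simp add: sgn_apex_def)
  ultimately have v: "x v \<noteq> 0" by (simp add: x_def)
  have "v \<in> \<Union>F" using triangulated by (simp add: triangulated_closed_surface_def)
  then obtain t where t: "t \<in> F" "v \<in> t" by blast
  then have "card t = 3" using triangulated by (simp add: triangulated_closed_surface_def)
  then obtain i j k where ijk: "t = {i, j, k}" by (auto simp: card_3_iff)
  let ?P = "\<lambda>f (i, j, k). face_pairing x f i j k"
  let ?T = "{(i, j, k). {i, j, k} \<in> F}"
  have "sum (?P f) ?T < sum (?P g) ?T"
  proof (rule sum_strict_mono_ex1)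
    show "\<forall>p\<in>?T. ?P f p \<le> ?P g p"
    proof clarify
      fix i j k assume F: "{i, j, k} \<in> F"
      show "face_pairing x f i j k \<le> face_pairing x g i j k"
        \<comment> \<open>If \<open>x\<close> vanishes at all three vertices, both pairings are
          zero.\<close>
        using less[OF F] by (cases "x i \<noteq> 0 \<or> x j \<noteq> 0 \<or> x k \<noteq> 0") (auto simp: face_pairing_def)
    qed
    show "\<exists>p\<in>?T. ?P f p < ?P g p"
      using less[of i j k] t v ijk by (intro bexI[of _ "(i, j, k)"]) auto
  qed simp
  moreover have "sum (?P f) ?T = sum (?P g) ?T"
    using curvature_pairing[of x f] curvature_pairing[of x g] K by simp
  ultimately show False by simp
qed

end

theorem theorem6p5:
  fixes F :: "'n::finite set set"
    and B :: "'n set set"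
    and \<eta> :: "'n set \<Rightarrow> real"
    and d :: "real ^ 'n \<Rightarrow> 'n \<Rightarrow> 'n \<Rightarrow> real"
  assumes "triangulated_closed_surface F"
    and "mixed_structure_III F B \<eta> d"
    and "((\<forall>t\<in>F. type_III_face F B \<eta> d t) \<and>
          (\<forall>i j k. type_III F B \<eta> d i j k \<longrightarrow> weight_condition \<eta> i j k)) \<or>
         (\<not> (\<forall>t\<in>F. type_III_face F B \<eta> d t) \<and>
          (\<forall>i j k. type_III F B \<eta> d i j k \<longrightarrow> weight_condition \<eta> i j k) \<and>
          (\<forall>t\<in>F. all_A3 B t \<longrightarrow> (\<forall>e. e \<subseteq> t \<and> card e = 2 \<longrightarrow> \<eta> e > 0)))"
  shows "inj_on (curvature F d) (admissible_space F B \<eta>)"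
proof -
  interpret mixed_surface F B \<eta> d using assms(1,2) by unfold_locales
  show ?thesis by (rule curvature_inj)
qed

end
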